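(* Let $V=\mathbb R^n$, and let $I\subseteq\bigwedge V$ be a graded ideal. Let $A=\{a_1,\dots,a_m\}$ be a minimal set of homogeneous generators for $I$, where $a_i\in\bigwedge^{r_i}V$. Then $$\sum_{i=1}^m\frac{1}{\binom{n}{r_i}}\le 1.$$ Equality occurs only when $\operatorname{span}A=\bigwedge^r V$ for some $r$.
   Context: $\bigwedge V=\bigoplus_{r=0}^n\bigwedge^r V$ is the exterior algebra with its standard grading. An ideal $I\subseteq\bigwedge V$ is graded if $I=\bigoplus_{r=0}^n\left(I\cap\bigwedge^r V\right)$; equivalently, $I$ is generated by homogeneous (not necessarily decomposable) elements. Graded ideals in $\bigwedge V$ are two-sided. A minimal set of homogeneous generators is a set of homogeneous elements generating $I$ as an ideal, no proper subset of which generates $I$. *)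

theory Defs
  imports "HOL-Analysis.Analysis"
begin

(* The exterior algebra of V = real ^ 'n in coordinates: x $ S is the coefficient of
   e_S = e_{i_1} \<and> ... \<and> e_{i_k}, where S = {i_1 < ... < i_k}.  The linear order on the index
   type 'n serves only to fix this basis. *)

type_synonym 'n exterior = "real ^ ('n set)"

definition blade :: "'n::finite set \<Rightarrow> 'n exterior" where
  "blade S = axis S 1"

definition ext_one :: "'n::finite exterior" where
  "ext_one = blade {}"

definition ext_vec :: "real ^ 'n \<Rightarrow> 'n::finite exterior" where
  "ext_vec v = (\<Sum>i\<in>UNIV. (v $ i) *\<^sub>R blade {i})"

(* For disjoint S and T, this is the sign of the permutation that sorts the sequence
   consisting of S in increasing order followed by T in increasing order. *)

definition wedge_sign :: "'n::{finite,linorder} set \<Rightarrow> 'n set \<Rightarrow> real" where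
  "wedge_sign S T = (-1) ^ card {(i, j). i \<in> S \<and> j \<in> T \<and> j < i}"

(* The bilinear product with e_S \<and> e_T = wedge_sign S T * e_(S \<union> T) if S and T are disjoint,
   and 0 otherwise. *)

definition wedge ::
  "'n::{finite,linorder} exterior \<Rightarrow> 'n exterior \<Rightarrow> 'n exterior"  (infixl \<open>\<^bold>\<and>\<close> 70) where
  "x \<^bold>\<and> y = (\<chi> U. \<Sum>S\<in>Pow U. wedge_sign S (U - S) * x $ S * y $ (U - S))"

definition ext_power :: "nat \<Rightarrow> ('n::finite exterior) set" where
  "ext_power r = span {blade S | S. card S = r}"

definition ext_ideal :: "('n::{finite,linorder} exterior) set \<Rightarrow> bool" where
  "ext_ideal I \<longleftrightarrow> subspace I \<and> (\<forall>x\<in>I. \<forall>a. a \<^bold>\<and> x \<in> I \<and> x \<^bold>\<and> a \<in> I)"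

(* The sum of the subspaces I \<inter> ext_power r is automatically direct, as the exterior
   powers have disjoint supports in the basis of blades. *)

definition graded_ideal :: "('n::{finite,linorder} exterior) set \<Rightarrow> bool" where
  "graded_ideal I \<longleftrightarrow> ext_ideal I \<and>
     I = {(\<Sum>r\<le>CARD('n). f r) | f. \<forall>r\<le>CARD('n). f r \<in> I \<inter> ext_power r}"

definition ext_homogeneous :: "'n::finite exterior \<Rightarrow> bool" where
  "ext_homogeneous x \<longleftrightarrow> (\<exists>r. x \<in> ext_power r)"

definition minimal_homogeneous_generators ::
  "('n::{finite,linorder} exterior) set \<Rightarrow> 'n exterior set \<Rightarrow> bool" where
  "minimal_homogeneous_generators A I \<longleftrightarrow>
     (\<forall>a\<in>A. ext_homogeneous a) \<and> ext_ideal hull A = I \<and>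
     (\<forall>B. B \<subset> A \<longrightarrow> ext_ideal hull B \<noteq> I)"


(* The remaining facts confirm that this is the exterior algebra: an associative unital algebra
   generated by V, in which squares of vectors vanish, and graded by the spans of the r-fold
   products of vectors.  The blades are a basis by construction and, by blade_insert_less, they
   are the increasing products of standard basis vectors. *)

lemma blade_nth: "blade S $ T = (if T = S then 1 else 0)"
  by (simp add: blade_def axis_def)

lemma blade_expansion: "x = (\<Sum>S\<in>UNIV. (x $ S) *\<^sub>R blade S)"
  by (simp add: vec_eq_iff blade_nth if_distrib cong: if_cong)

lemma bilinear_wedge: "bilinear wedge"
  unfolding bilinear_def wedge_def
  by (auto intro!: linearI simp: vec_eq_iff algebra_simps sum.distrib sum_distrib_left)

lemma wedge_blade:
  "blade S \<^bold>\<and> blade T = (if S \<inter> T = {} then wedge_sign S T *\<^sub>R blade (S \<union> T) else 0)"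
proof -
  have "(blade S \<^bold>\<and> blade T) $ U =
      (if S \<inter> T = {} then wedge_sign S T *\<^sub>R blade (S \<union> T) else 0) $ U" for U
  proof -
    have "(blade S \<^bold>\<and> blade T) $ U =
        (\<Sum>R\<in>Pow U. if R = S then wedge_sign S (U - S) * blade T $ (U - S) else 0)"
      unfolding wedge_def vec_lambda_beta by (rule sum.cong) (auto simp: blade_nth)
    also have "\<dots> = (if S \<subseteq> U then wedge_sign S (U - S) * blade T $ (U - S) else 0)"
      by (simp add: sum.delta)
    also have "\<dots> = (if S \<inter> T = {} then wedge_sign S T *\<^sub>R blade (S \<union> T) else 0) $ U"
    proof (cases "S \<inter> T = {} \<and> U = S \<union> T")
      case True
      then have "U - S = T" by blast
      then show ?thesis using True by (auto simp only: blade_nth) (simp add: blade_nth)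
    next
      case False
      then have "\<not> (S \<subseteq> U \<and> U - S = T)" by blast
      then show ?thesis using False by (simp add: blade_nth)
    qed
    finally show ?thesis .
  qed
  then show ?thesis by (simp add: vec_eq_iff)
qed

lemma wedge_sign_Un_left:
  assumes "S \<inter> T = {}"
  shows "wedge_sign (S \<union> T) U = wedge_sign S U * wedge_sign T U"
proof -
  have "{(i, j). i \<in> S \<union> T \<and> j \<in> U \<and> j < i} =
      {(i, j). i \<in> S \<and> j \<in> U \<and> j < i} \<union> {(i, j). i \<in> T \<and> j \<in> U \<and> j < i}"
    by auto
  moreover have "{(i, j). i \<in> S \<and> j \<in> U \<and> j < i} \<inter> {(i, j). i \<in> T \<and> j \<in> U \<and> j < i} = {}"
    using assms by auto
  ultimately show ?thesis
    by (simp add: wedge_sign_def card_Un_disjoint power_add)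
qed

lemma wedge_sign_Un_right:
  assumes "T \<inter> U = {}"
  shows "wedge_sign S (T \<union> U) = wedge_sign S T * wedge_sign S U"
proof -
  have "{(i, j). i \<in> S \<and> j \<in> T \<union> U \<and> j < i} =
      {(i, j). i \<in> S \<and> j \<in> T \<and> j < i} \<union> {(i, j). i \<in> S \<and> j \<in> U \<and> j < i}"
    by auto
  moreover have "{(i, j). i \<in> S \<and> j \<in> T \<and> j < i} \<inter> {(i, j). i \<in> S \<and> j \<in> U \<and> j < i} = {}"
    using assms by auto
  ultimately show ?thesis
    by (simp add: wedge_sign_def card_Un_disjoint power_add)
qed

lemma linear_wedge_right: "linear (\<lambda>y. x \<^bold>\<and> y)"
  and linear_wedge_left: "linear (\<lambda>x. x \<^bold>\<and> y)"
  using bilinear_wedge by (auto simp: bilinear_def)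

lemmas wedge_linear_simps =
  linear_add[OF linear_wedge_right] linear_add[OF linear_wedge_left]
  linear_scale[OF linear_wedge_right] linear_scale[OF linear_wedge_left]
  linear_sum[OF linear_wedge_right] linear_sum[OF linear_wedge_left]
  linear_0[OF linear_wedge_right] linear_0[OF linear_wedge_left]

lemma wedge_assoc_blade:
  "(blade S \<^bold>\<and> blade T) \<^bold>\<and> blade U = blade S \<^bold>\<and> (blade T \<^bold>\<and> blade U)"
  by (auto simp: wedge_blade wedge_linear_simps wedge_sign_Un_left wedge_sign_Un_right
      Int_Un_distrib Int_Un_distrib2 Un_assoc)

lemma linear_eq_blade:
  assumes "linear f" "linear g" "\<And>S. f (blade S) = g (blade S)"
  shows "f x = g x"
proof -
  have "f x = (\<Sum>S\<in>UNIV. (x $ S) *\<^sub>R f (blade S))"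
    by (subst blade_expansion[of x]) (simp add: linear_sum[OF assms(1)] linear_scale[OF assms(1)])
  also have "\<dots> = (\<Sum>S\<in>UNIV. (x $ S) *\<^sub>R g (blade S))"
    by (simp add: assms(3))
  also have "\<dots> = g x"
    by (subst (2) blade_expansion[of x]) (simp add: linear_sum[OF assms(2)] linear_scale[OF assms(2)])
  finally show ?thesis .
qed

lemma wedge_assoc: "(x \<^bold>\<and> y) \<^bold>\<and> z = x \<^bold>\<and> (y \<^bold>\<and> z)"
proof -
  have 1: "(blade S \<^bold>\<and> blade T) \<^bold>\<and> z = blade S \<^bold>\<and> (blade T \<^bold>\<and> z)" for S T
    by (rule linear_eq_blade[of "\<lambda>z. (blade S \<^bold>\<and> blade T) \<^bold>\<and> z"])
      (auto intro!: linearI simp: wedge_linear_simps wedge_assoc_blade)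
  have 2: "(blade S \<^bold>\<and> y) \<^bold>\<and> z = blade S \<^bold>\<and> (y \<^bold>\<and> z)" for S
    by (rule linear_eq_blade[of "\<lambda>y. (blade S \<^bold>\<and> y) \<^bold>\<and> z"])
      (auto intro!: linearI simp: wedge_linear_simps 1)
  show ?thesis
    by (rule linear_eq_blade[of "\<lambda>x. (x \<^bold>\<and> y) \<^bold>\<and> z"])
      (auto intro!: linearI simp: wedge_linear_simps 2)
qed

lemma wedge_one_left: "ext_one \<^bold>\<and> x = x"
  by (rule linear_eq_blade[of "\<lambda>x. ext_one \<^bold>\<and> x"])
    (auto intro!: linearI simp: wedge_linear_simps ext_one_def wedge_blade wedge_sign_def)

lemma wedge_one_right: "x \<^bold>\<and> ext_one = x"
  by (rule linear_eq_blade[of "\<lambda>x. x \<^bold>\<and> ext_one"])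
    (auto intro!: linearI simp: wedge_linear_simps ext_one_def wedge_blade wedge_sign_def)

lemma blade_singletons_anticommute: "blade {i} \<^bold>\<and> blade {j} = - (blade {j} \<^bold>\<and> blade {i})"
proof -
  have *: "{(k, l). k \<in> {i} \<and> l \<in> {j} \<and> l < k} = (if j < i then {(i, j)} else {})" for i j :: 'a
    by auto
  show ?thesis
    unfolding wedge_blade wedge_sign_def * by (auto simp: insert_commute)
qed

lemma ext_vec_square: "ext_vec v \<^bold>\<and> ext_vec v = 0"
proof -
  let ?s = "\<Sum>i\<in>UNIV. \<Sum>j\<in>UNIV. (v $ i * v $ j) *\<^sub>R (blade {i} \<^bold>\<and> blade {j})"
  have "ext_vec v \<^bold>\<and> ext_vec v = ?s"
    unfolding ext_vec_def
    by (simp add: wedge_linear_simps scaleR_sum_right) (subst sum.swap, simp add: mult.commute)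
  moreover have "?s = - ?s"
  proof -
    have "?s = (\<Sum>j\<in>UNIV. \<Sum>i\<in>UNIV. (v $ i * v $ j) *\<^sub>R (blade {i} \<^bold>\<and> blade {j}))"
      by (rule sum.swap)
    also have "\<dots> = (\<Sum>j\<in>UNIV. \<Sum>i\<in>UNIV. - ((v $ j * v $ i) *\<^sub>R (blade {j} \<^bold>\<and> blade {i})))"
      by (intro sum.cong refl, subst blade_singletons_anticommute) (simp add: mult.commute)
    finally show ?thesis by (simp add: sum_negf)
  qed
  ultimately show ?thesis by (simp only: vec_eq_iff vector_uminus_component zero_index) simp
qed

lemma ext_power_iff: "x \<in> ext_power r \<longleftrightarrow> (\<forall>S. x $ S \<noteq> 0 \<longrightarrow> card S = r)"
proof
  assume "x \<in> ext_power r"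
  then show "\<forall>S. x $ S \<noteq> 0 \<longrightarrow> card S = r"
    unfolding ext_power_def
  proof (induction rule: span_induct_alt)
    case base
    then show ?case by simp
  next
    case (step c x y)
    then show ?case
      by (auto simp: blade_nth split: if_splits)
  qed
next
  assume *: "\<forall>S. x $ S \<noteq> 0 \<longrightarrow> card S = r"
  have "(\<Sum>S\<in>UNIV. (x $ S) *\<^sub>R blade S) \<in> ext_power r"
    unfolding ext_power_def
  proof (rule span_sum)
    fix S
    show "(x $ S) *\<^sub>R blade S \<in> span {blade S | S. card S = r}"
      using * by (cases "x $ S = 0") (auto intro: span_scale span_base simp: span_zero)
  qed
  then show "x \<in> ext_power r" by (subst blade_expansion)
qed

lemma wedge_ext_power:
  assumes "x \<in> ext_power r" "y \<in> ext_power s"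
  shows "x \<^bold>\<and> y \<in> ext_power (r + s)"
  unfolding ext_power_iff
proof (intro allI impI)
  fix U assume "(x \<^bold>\<and> y) $ U \<noteq> 0"
  then obtain S where S: "S \<subseteq> U" "wedge_sign S (U - S) * x $ S * y $ (U - S) \<noteq> 0"
    unfolding wedge_def by (auto elim!: sum.not_neutral_contains_not_neutral)
  then have "card S = r" "card (U - S) = s"
    using assms by (auto simp: ext_power_iff)
  then show "card U = r + s"
    using S(1) by (metis card_Diff_subset card_mono finite le_add_diff_inverse)
qed

lemma blade_insert_less:
  assumes "\<And>j. j \<in> S \<Longrightarrow> i < j"
  shows "blade (insert i S) = ext_vec (axis i 1) \<^bold>\<and> blade S"
proof -
  have v: "ext_vec (axis i 1) = blade {i}"
    by (simp add: ext_vec_def axis_def if_distrib[of "\<lambda>c. c *\<^sub>R _"] cong: if_cong)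
  have "{(k, l). k \<in> {i} \<and> l \<in> S \<and> l < k} = {}" "i \<notin> S"
    using assms by force+
  then have "wedge_sign {i} S = 1" "{i} \<inter> S = {}"
    unfolding wedge_sign_def by (simp_all only: card.empty power_0) simp
  then show ?thesis
    by (simp add: v wedge_blade)
qed

lemma ext_power_eq_span_products:
  "(ext_power r :: ('a::{finite,linorder} exterior) set) =
    span {foldr (\<lambda>v x. ext_vec v \<^bold>\<and> x) vs ext_one | vs. length vs = r}"
proof
  have one: "(ext_one :: 'a exterior) \<in> ext_power 0"
    by (auto simp: ext_power_iff ext_one_def blade_nth split: if_splits)
  have vec: "ext_vec v \<in> ext_power 1" for v :: "(real, 'a) vec"
    unfolding ext_vec_def ext_power_def by (intro span_sum span_scale span_base) auto
  have "foldr (\<lambda>v x. ext_vec v \<^bold>\<and> x) vs ext_one \<in> ext_power (length vs)" for vs :: "(real, 'a) vec list"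
  proof (induction vs)
    case Nil
    then show ?case using one by simp
  next
    case (Cons v vs)
    then show ?case using wedge_ext_power[OF vec Cons.IH] by simp
  qed
  then show "span {foldr (\<lambda>v x. ext_vec v \<^bold>\<and> x) vs ext_one | vs :: (real, 'a) vec list. length vs = r}
      \<subseteq> ext_power r"
    by (intro span_minimal) (auto simp: ext_power_def)
  have "\<exists>vs. length vs = card S \<and> blade S = foldr (\<lambda>v x. ext_vec v \<^bold>\<and> x) vs ext_one" for S :: "'a set"
  proof (induction "card S" arbitrary: S)
    case 0
    then show ?case by (auto simp: ext_one_def)
  next
    case (Suc k)
    define i where "i = Min S"
    have ne: "S \<noteq> {}" and i: "i \<in> S" using Suc(2) unfolding i_def by (auto intro!: Min_in)
    have less: "i < j" if "j \<in> S - {i}" for j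
      using that Min_le[of S j] unfolding i_def by (auto simp: order_less_le)
    have "k = card (S - {i})" using Suc(2) i by simp
    then obtain vs where "length vs = card (S - {i})"
        "blade (S - {i}) = foldr (\<lambda>v x. ext_vec v \<^bold>\<and> x) vs ext_one"
      using Suc(1) by blast
    moreover have "blade S = ext_vec (axis i 1) \<^bold>\<and> blade (S - {i})"
      using blade_insert_less[of "S - {i}" i] less i by (simp add: insert_absorb)
    ultimately show ?case
      using Suc(2) \<open>k = card (S - {i})\<close> by (intro exI[of _ "axis i 1 # vs"]) simp
  qed
  then show "ext_power r \<subseteq>
      span {foldr (\<lambda>v x. ext_vec v \<^bold>\<and> x) vs ext_one | vs :: (real, 'a) vec list. length vs = r}"
    unfolding ext_power_def by (intro span_mono) blast
qed

end

theory Submission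
  imports Defs
begin

text \<open>
  Why the inequality holds.  Let \<open>d k\<close> be the dimension of \<open>I \<inter> ext_power k\<close>, and let \<open>\<mu> k\<close> be the
  number of generators of degree \<open>k\<close> divided by \<open>n choose k\<close>.  By minimality the generators of degree
  \<open>k + 1\<close> are linearly independent modulo the subspace that \<open>I \<inter> ext_power k\<close> generates in degree
  \<open>k + 1\<close> (\<open>generators_independent_modulo_lower_degree\<close>).  An LYM inequality for subspaces
  (\<open>local_LYM_subspace\<close>) says that the density \<open>d k / (n choose k)\<close> does not decrease when a subspace
  of \<open>ext_power k\<close> is multiplied by all vectors.  Hence each step from degree \<open>k\<close> to \<open>k + 1\<close> raises
  the density of \<open>I\<close> by at least \<open>\<mu> (k + 1)\<close>; as a density never exceeds 1, the sum of all \<open>\<mu> k\<close> is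
  at most 1.

  The LYM inequality for subspaces is reduced to the one for set families by passing to leading
  monomials, as in the theory of Groebner bases.  For a monomial order on the blades, the family of
  leading blades of a subspace has as many members as the subspace has dimensions
  (\<open>card_initial_blades\<close>), and multiplying an element by a basis vector \<open>j\<close> outside its leading blade
  adds \<open>j\<close> to that blade (\<open>leading_blade_insert\<close>).  So the leading blades of the multiplied subspace
  contain the upper shadow of the leading blades of the original one.

  Equality.  The density of a set family grows strictly when passing to the upper shadow, unless the
  family is empty or contains all sets of its size.  So if the sum is 1, then the density jumps from 0
  to 1 at a single degree \<open>s\<close> (\<open>saturated_increments\<close>); there are \<open>n choose s\<close> generators of degree
  \<open>s\<close> and none of any other degree, and being independent they span \<open>ext_power s\<close>.
\<close>

section \<open>Leading blades\<close>

text \<open>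
  Reading a set of indices as a binary number orders the blades totally, and inserting an index that
  two sets both lack preserves their order: this is a monomial order.
\<close>

definition monomial_rank :: "'n::finite set \<Rightarrow> nat" where
  "monomial_rank S = set_encode (to_nat ` S)"

lemma monomial_rank_inject: "monomial_rank S = monomial_rank T \<longleftrightarrow> S = T"
  unfolding monomial_rank_def by (simp add: set_encode_eq inj_image_eq_iff)

lemma monomial_rank_insert: "j \<notin> S \<Longrightarrow> monomial_rank (insert j S) = 2 ^ to_nat j + monomial_rank S"
  unfolding monomial_rank_def by (simp add: inj_image_mem_iff)

definition leading_blade :: "'n::finite exterior \<Rightarrow> 'n set \<Rightarrow> bool" where
  "leading_blade x S \<longleftrightarrow> x $ S \<noteq> 0 \<and> (\<forall>T. x $ T \<noteq> 0 \<longrightarrow> monomial_rank T \<le> monomial_rank S)"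

definition initial_blades :: "('n::finite exterior) set \<Rightarrow> 'n set set" where
  "initial_blades W = {S. \<exists>x\<in>W. leading_blade x S}"

lemma leading_blade_exists:
  assumes "x \<noteq> 0"
  obtains S where "leading_blade x S"
proof -
  obtain S0 where "x $ S0 \<noteq> 0" using assms by (auto simp: vec_eq_iff)
  then have "Max (monomial_rank ` {T. x $ T \<noteq> 0}) \<in> monomial_rank ` {T. x $ T \<noteq> 0}"
    by (intro Max_in) auto
  then obtain S where "x $ S \<noteq> 0" "Max (monomial_rank ` {T. x $ T \<noteq> 0}) = monomial_rank S"
    by blast
  moreover from this have "monomial_rank T \<le> monomial_rank S" if "x $ T \<noteq> 0" for T
    using that Max_ge[of "monomial_rank ` {T. x $ T \<noteq> 0}" "monomial_rank T"] by auto
  ultimately show thesis using that unfolding leading_blade_def by blast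
qed

text \<open>
  Triangularity: all elements whose leading blades rank below \<open>S\<close> vanish at the coordinate \<open>S\<close>, so an
  element with leading blade \<open>S\<close> is not in their span.
\<close>

lemma card_le_dim_of_leading_blades:
  assumes "\<And>S. S \<in> F \<Longrightarrow> leading_blade (X S) S"
  shows "card F \<le> dim (X ` F)"
proof -
  have "finite F" by simp
  then show ?thesis using assms
  proof (induction rule: finite_ranking_induct[where f = monomial_rank])
    case empty
    then show ?case by simp
  next
    case (insert S F)
    show ?case
    proof (cases "S \<in> F")
      case True
      then show ?thesis using insert by (simp add: insert_absorb)
    next
      case False
      have "X T $ S = 0" if "T \<in> F" for T
        using that False insert(2)[OF that] insert(4)[of T] monomial_rank_inject[of S T]
        unfolding leading_blade_def by fastforce
      moreover have "subspace {y :: 'a exterior. y $ S = 0}"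
        by (auto simp: subspace_def)
      ultimately have "span (X ` F) \<subseteq> {y. y $ S = 0}"
        by (intro span_minimal) auto
      moreover have "X S $ S \<noteq> 0"
        using insert(4)[of S] unfolding leading_blade_def by simp
      ultimately have "X S \<notin> span (X ` F)" by blast
      then show ?thesis using insert False by (simp add: eucl.dim_insert)
    qed
  qed
qed

text \<open>
  Elements with distinct leading blades are independent; conversely an element of \<open>W\<close> is determined
  by its coefficients at the leading blades of \<open>W\<close>, since the difference of two elements that agree
  there has no leading blade.
\<close>

lemma card_initial_blades:
  assumes "subspace W"
  shows "card (initial_blades W) = dim W"
proof (rule antisym)
  obtain X where X: "\<And>S. S \<in> initial_blades W \<Longrightarrow> X S \<in> W \<and> leading_blade (X S) S"
    unfolding initial_blades_def by (atomize_elim, rule choice) auto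
  then have "card (initial_blades W) \<le> dim (X ` initial_blades W)"
    by (intro card_le_dim_of_leading_blades) blast
  also have "\<dots> \<le> dim W"
    using X by (intro dim_subset) blast
  finally show "card (initial_blades W) \<le> dim W" .
next
  let ?p = "\<lambda>x :: 'a exterior. \<Sum>S\<in>initial_blades W. (x $ S) *\<^sub>R blade S"
  have lin: "linear ?p"
    by (auto intro!: linearI simp: scaleR_add_left sum.distrib scaleR_sum_right)
  have "x = 0" if "x \<in> W" "?p x = 0" for x
  proof (rule ccontr)
    assume "x \<noteq> 0"
    then obtain S where S: "leading_blade x S" by (rule leading_blade_exists)
    then have "S \<in> initial_blades W" using that unfolding initial_blades_def by blast
    then have "?p x $ S = x $ S"
      by (simp add: blade_nth if_distrib cong: if_cong)
    then show False using S that unfolding leading_blade_def by simp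
  qed
  then have "inj_on ?p W"
    using linear_injective_on_subspace_0[OF lin assms] by blast
  then have "inj_on ?p (span W)"
    using assms by (simp add: span_eq_iff[THEN iffD2])
  then have "dim W = dim (?p ` W)"
    by (rule eucl.dim_image_eq[OF lin, symmetric])
  also have "\<dots> \<le> card (blade ` initial_blades W)"
    by (intro dim_le_card) (auto intro!: span_sum intro: span_scale span_base)
  also have "\<dots> \<le> card (initial_blades W)"
    by (simp add: card_image_le)
  finally show "dim W \<le> card (initial_blades W)" .
qed

lemma initial_blades_ext_power: "W \<subseteq> ext_power r \<Longrightarrow> S \<in> initial_blades W \<Longrightarrow> card S = r"
  unfolding initial_blades_def leading_blade_def by (auto simp: ext_power_iff)

lemma subspace_ext_power: "subspace (ext_power r)"
  unfolding ext_power_def by simp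

lemma card_sets_of_card: "card {S :: 'n::finite set. card S = r} = CARD('n) choose r"
  using n_subsets[of "UNIV :: 'n set" r] by simp

lemma dim_ext_power: "dim (ext_power r :: ('n::finite exterior) set) = CARD('n) choose r"
proof -
  have "blade S \<in> ext_power (card S)" "leading_blade (blade S) S" for S :: "'n set"
    by (auto simp: ext_power_iff leading_blade_def blade_nth split: if_splits)
  then have "initial_blades (ext_power r) = {S :: 'n set. card S = r}"
    using initial_blades_ext_power[OF order_refl] unfolding initial_blades_def by blast
  then show ?thesis
    using card_initial_blades[OF subspace_ext_power] card_sets_of_card by metis
qed

lemma wedge_blade_left_nth:
  "(blade S \<^bold>\<and> x) $ U = (if S \<subseteq> U then wedge_sign S (U - S) * x $ (U - S) else 0)"
proof -
  have "(blade S \<^bold>\<and> x) $ U =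
      (\<Sum>R\<in>Pow U. if R = S then wedge_sign S (U - S) * x $ (U - S) else 0)"
    unfolding wedge_def vec_lambda_beta by (rule sum.cong) (auto simp: blade_nth)
  then show ?thesis by (simp add: sum.delta)
qed

lemma wedge_blade_right_nth:
  "(x \<^bold>\<and> blade T) $ U = (if T \<subseteq> U then wedge_sign (U - T) T * x $ (U - T) else 0)"
proof (cases "T \<subseteq> U")
  case True
  have "(x \<^bold>\<and> blade T) $ U =
      (\<Sum>R\<in>Pow U. if R = U - T then wedge_sign (U - T) T * x $ (U - T) else 0)"
    unfolding wedge_def vec_lambda_beta
  proof (rule sum.cong[OF refl])
    fix R assume "R \<in> Pow U"
    then have "U - R = T \<longleftrightarrow> R = U - T" using True by blast
    then show "wedge_sign R (U - R) * x $ R * blade T $ (U - R) =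
        (if R = U - T then wedge_sign (U - T) T * x $ (U - T) else 0)"
      using True by (auto simp: blade_nth double_diff)
  qed
  then show ?thesis using True by (simp add: sum.delta)
next
  case False
  then have "U - R \<noteq> T" for R by blast
  then show ?thesis using False by (simp add: wedge_def blade_nth)
qed

text \<open>
  Multiplication by \<open>j\<close> kills the blades containing \<open>j\<close> and adds \<open>j\<close> to the others.  The leading blade
  survives because it lacks \<open>j\<close>, and it stays on top because the order is a monomial order.
\<close>

lemma leading_blade_insert:
  assumes "leading_blade x S" "j \<notin> S"
  shows "leading_blade (blade {j} \<^bold>\<and> x) (insert j S)"
  unfolding leading_blade_def
proof (intro conjI allI impI)
  show "(blade {j} \<^bold>\<and> x) $ insert j S \<noteq> 0"
    using assms unfolding leading_blade_def by (simp add: wedge_blade_left_nth wedge_sign_def)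
next
  fix T assume "(blade {j} \<^bold>\<and> x) $ T \<noteq> 0"
  then have j: "j \<in> T" and "x $ (T - {j}) \<noteq> 0"
    by (auto simp: wedge_blade_left_nth split: if_splits)
  then have "monomial_rank (T - {j}) \<le> monomial_rank S"
    using assms(1) unfolding leading_blade_def by blast
  moreover have "monomial_rank T = 2 ^ to_nat j + monomial_rank (T - {j})"
    using monomial_rank_insert[of j "T - {j}"] j by (simp add: insert_absorb)
  ultimately show "monomial_rank T \<le> monomial_rank (insert j S)"
    using monomial_rank_insert[OF assms(2)] by simp
qed

section \<open>The local LYM inequality\<close>

text \<open>
  Double counting of the pairs of a set and a one-element extension of it: every member of \<open>F\<close> has
  \<open>n - r\<close> extensions, and every member of \<open>G\<close> has \<open>r + 1\<close> restrictions, which may lie in \<open>F\<close> or not.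
  Equality forces all of them to lie in \<open>F\<close>.
\<close>

lemma local_LYM:
  fixes F G :: "'n::finite set set"
  assumes F: "\<And>S. S \<in> F \<Longrightarrow> card S = r" and G: "\<And>T. T \<in> G \<Longrightarrow> card T = Suc r"
    and shadow: "\<And>S j. S \<in> F \<Longrightarrow> j \<notin> S \<Longrightarrow> insert j S \<in> G"
  shows "card F * (CARD('n) - r) \<le> card G * Suc r"
    and "card F * (CARD('n) - r) = card G * Suc r \<Longrightarrow> T \<in> G \<Longrightarrow> i \<in> T \<Longrightarrow> T - {i} \<in> F"
proof -
  let ?P = "SIGMA S:F. - S" and ?Q = "SIGMA T:G. T"
  let ?f = "\<lambda>(S, j). (insert j S, j)"
  have P: "card ?P = card F * (CARD('n) - r)"
    using F by (simp add: card_SigmaI Compl_eq_Diff_UNIV card_Diff_subset)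
  have Q: "card ?Q = card G * Suc r"
    using G by (simp add: card_SigmaI)
  have inj: "inj_on ?f ?P"
    by (clarsimp simp: inj_on_def) (metis insert_ident)
  have sub: "?f ` ?P \<subseteq> ?Q" using shadow by auto
  show "card F * (CARD('n) - r) \<le> card G * Suc r"
    using card_inj_on_le[OF inj sub] P Q by simp
  assume eq: "card F * (CARD('n) - r) = card G * Suc r" and T: "T \<in> G" "i \<in> T"
  have "?f ` ?P = ?Q"
    using sub eq P Q card_image[OF inj] by (intro card_subset_eq) auto
  then have "(T, i) \<in> ?f ` ?P" using T by auto
  then show "T - {i} \<in> F" by auto
qed

text \<open>
  Any two sets of the same size are joined by a chain of exchanges: exchanging an index of \<open>S - S'\<close>
  for one of \<open>S' - S\<close> brings \<open>S\<close> closer to \<open>S'\<close>.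
\<close>

lemma exchange_closed_family_contains_all:
  fixes F :: "'n::finite set set"
  assumes "S \<in> F" "card S = card S'"
    and exchange: "\<And>S j i. S \<in> F \<Longrightarrow> j \<notin> S \<Longrightarrow> i \<in> S \<Longrightarrow> insert j S - {i} \<in> F"
  shows "S' \<in> F"
  using assms(1,2)
proof (induction "card (S' - S)" arbitrary: S rule: less_induct)
  case less
  show ?case
  proof (cases "S = S'")
    case True
    then show ?thesis using less by simp
  next
    case False
    have "\<not> S' \<subseteq> S" "\<not> S \<subseteq> S'"
      using False less(3) card_subset_eq[of S S'] card_subset_eq[of S' S] by auto
    then obtain j i where ji: "j \<in> S'" "j \<notin> S" "i \<in> S" "i \<notin> S'" by blast
    have "S' - (insert j S - {i}) \<subset> S' - S" using ji by blast
    then have "card (S' - (insert j S - {i})) < card (S' - S)"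
      by (simp add: psubset_card_mono)
    moreover have "insert j S - {i} \<in> F" using exchange ji less(2) by blast
    moreover have "card (insert j S - {i}) = card S'" using ji less(3) by simp
    ultimately show ?thesis using less(1) by blast
  qed
qed

text \<open>
  The set families are the leading blades of \<open>W\<close> and \<open>W'\<close>; their cardinalities are the dimensions.
  In the case of equality the leading blades of \<open>W\<close> are closed under exchanging one index.
\<close>

lemma local_LYM_subspace:
  fixes W W' :: "('n::{finite,linorder} exterior) set"
  assumes "subspace W" "W \<subseteq> ext_power r" "subspace W'" "W' \<subseteq> ext_power (Suc r)"
    and r: "r < CARD('n)"
    and prod: "\<And>x j. x \<in> W \<Longrightarrow> blade {j} \<^bold>\<and> x \<in> W'"
  shows "dim W / (CARD('n) choose r) \<le> dim W' / (CARD('n) choose Suc r)"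
    and "dim W / (CARD('n) choose r) = dim W' / (CARD('n) choose Suc r)
      \<Longrightarrow> dim W = 0 \<or> dim W = CARD('n) choose r"
proof -
  let ?F = "initial_blades W" and ?G = "initial_blades W'" and ?n = "CARD('n)"
  have F: "card S = r" if "S \<in> ?F" for S
    using initial_blades_ext_power[OF assms(2) that] .
  have G: "card T = Suc r" if "T \<in> ?G" for T
    using initial_blades_ext_power[OF assms(4) that] .
  have shadow: "insert j S \<in> ?G" if "S \<in> ?F" "j \<notin> S" for S j
    using that leading_blade_insert prod unfolding initial_blades_def by blast
  note card = card_initial_blades[OF assms(1)] card_initial_blades[OF assms(3)]
  have "(?n - r) * (?n choose r) = Suc r * (?n choose Suc r)"
    by (simp only: binomial_absorb_comp binomial_absorption)
  then have "real (?n - r) * real (?n choose r) = real (Suc r) * real (?n choose Suc r)"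
    by (metis of_nat_mult)
  moreover have pos: "real (?n choose r) > 0" "real (?n choose Suc r) > 0" "real (?n - r) > 0"
      "real (Suc r) > 0"
    using r by auto
  ultimately have ratio: "real (?n choose Suc r) = real (?n - r) * real (?n choose r) / real (Suc r)"
    by (simp add: field_simps)
  \<comment> \<open>The ratio of the two binomial coefficients turns densities into the counts of \<open>local_LYM\<close>.\<close>
  have le: "real d / (?n choose r) \<le> real d' / (?n choose Suc r) \<longleftrightarrow> d * (?n - r) \<le> d' * Suc r"
    and eq: "real d / (?n choose r) = real d' / (?n choose Suc r) \<longleftrightarrow> d * (?n - r) = d' * Suc r"
    for d d'
  proof -
    have d': "real d' / (?n choose Suc r) = real (d' * Suc r) / real (?n - r) / (?n choose r)"
      unfolding ratio using pos by (simp add: field_simps)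
    have d: "real d = real (d * (?n - r)) / real (?n - r)"
      using pos by simp
    show "real d / (?n choose r) \<le> real d' / (?n choose Suc r) \<longleftrightarrow> d * (?n - r) \<le> d' * Suc r"
      unfolding d' using pos
      by (subst d) (simp only: divide_le_cancel of_nat_le_iff, simp)
    show "real d / (?n choose r) = real d' / (?n choose Suc r) \<longleftrightarrow> d * (?n - r) = d' * Suc r"
      unfolding d' using pos
      by (subst d) (simp only: divide_cancel_right of_nat_eq_iff, simp)
  qed
  show "dim W / (?n choose r) \<le> dim W' / (?n choose Suc r)"
    unfolding le using local_LYM(1)[of ?F r ?G] F G shadow card by simp
  assume "dim W / (?n choose r) = dim W' / (?n choose Suc r)"
  then have eq': "card ?F * (?n - r) = card ?G * Suc r" unfolding eq card .
  have exchange: "insert j S - {i} \<in> ?F" if "S \<in> ?F" "j \<notin> S" "i \<in> S" for S j i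
    using local_LYM(2)[of ?F r ?G, OF F G shadow eq' shadow[OF that(1,2)]] that by blast
  have "?F = {S. card S = r}" if "S \<in> ?F" for S
    using F that exchange_closed_family_contains_all[of S ?F] exchange by blast
  then show "dim W = 0 \<or> dim W = ?n choose r"
    using card card_sets_of_card[where 'n = 'n, of r] by (metis card.empty ex_in_conv)
qed

section \<open>Minimal generators are independent modulo lower degree\<close>

definition graded_part :: "nat \<Rightarrow> 'n::finite exterior \<Rightarrow> 'n exterior" where
  "graded_part k x = (\<chi> S. if card S = k then x $ S else 0)"

lemma linear_graded_part: "linear (graded_part k)"
  by (auto intro!: linearI simp: graded_part_def vec_eq_iff)

lemma graded_part_homogeneous:
  assumes "x \<in> ext_power r"
  shows "graded_part k x = (if k = r then x else 0)"
  using assms unfolding ext_power_iff graded_part_def by (auto simp: vec_eq_iff)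

lemma graded_part_wedge_blade_left:
  "graded_part k (blade S \<^bold>\<and> x) =
    (if card S \<le> k then blade S \<^bold>\<and> graded_part (k - card S) x else 0)"
proof -
  have "card (U - S) = k - card S \<longleftrightarrow> card U = k" if "S \<subseteq> U" "card S \<le> k" for U
    using that by (auto simp: card_Diff_subset dest: card_mono[OF finite])
  moreover have "card U \<noteq> k" if "S \<subseteq> U" "\<not> card S \<le> k" for U
    using that card_mono[OF finite that(1)] by simp
  ultimately show ?thesis
    by (auto simp: vec_eq_iff graded_part_def wedge_blade_left_nth)
qed

lemma graded_part_wedge_blade_right:
  "graded_part k (x \<^bold>\<and> blade S) =
    (if card S \<le> k then graded_part (k - card S) x \<^bold>\<and> blade S else 0)"
proof -
  have "card (U - S) = k - card S \<longleftrightarrow> card U = k" if "S \<subseteq> U" "card S \<le> k" for U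
    using that by (auto simp: card_Diff_subset dest: card_mono[OF finite])
  moreover have "card U \<noteq> k" if "S \<subseteq> U" "\<not> card S \<le> k" for U
    using that card_mono[OF finite that(1)] by simp
  ultimately show ?thesis
    by (auto simp: vec_eq_iff graded_part_def wedge_blade_right_nth)
qed

lemma ext_idealI_blades:
  assumes "subspace I"
    and "\<And>x S. x \<in> I \<Longrightarrow> blade S \<^bold>\<and> x \<in> I" "\<And>x S. x \<in> I \<Longrightarrow> x \<^bold>\<and> blade S \<in> I"
  shows "ext_ideal I"
  unfolding ext_ideal_def
proof (intro conjI ballI allI)
  fix x a assume x: "x \<in> I"
  have "a \<^bold>\<and> x = (\<Sum>S\<in>UNIV. (a $ S) *\<^sub>R (blade S \<^bold>\<and> x))"
    by (subst blade_expansion[of a]) (simp add: wedge_linear_simps)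
  also have "\<dots> \<in> I" by (intro subspace_sum subspace_scale assms x)
  finally show "a \<^bold>\<and> x \<in> I" .
  have "x \<^bold>\<and> a = (\<Sum>S\<in>UNIV. (a $ S) *\<^sub>R (x \<^bold>\<and> blade S))"
    by (subst blade_expansion[of a]) (simp add: wedge_linear_simps)
  also have "\<dots> \<in> I" by (intro subspace_sum subspace_scale assms x)
  finally show "x \<^bold>\<and> a \<in> I" .
qed (rule assms)

lemma ext_ideal_low_degree_parts:
  assumes "ext_ideal J"
  shows "ext_ideal {x. \<forall>k<r. graded_part k x \<in> J}"
proof (rule ext_idealI_blades)
  have J: "subspace J" using assms unfolding ext_ideal_def by blast
  then show "subspace {x. \<forall>k<r. graded_part k x \<in> J}"
    by (auto simp: subspace_def linear_0[OF linear_graded_part] linear_add[OF linear_graded_part]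
        linear_scale[OF linear_graded_part])
  show "blade S \<^bold>\<and> x \<in> {x. \<forall>k<r. graded_part k x \<in> J}"
    and "x \<^bold>\<and> blade S \<in> {x. \<forall>k<r. graded_part k x \<in> J}"
    if "x \<in> {x. \<forall>k<r. graded_part k x \<in> J}" for x S
    using that assms subspace_0[OF J] unfolding ext_ideal_def
    by (auto simp: graded_part_wedge_blade_left graded_part_wedge_blade_right)
qed

lemma ext_ideal_hull: "ext_ideal (ext_ideal hull A)"
  by (rule hull_in) (auto simp: ext_ideal_def intro!: subspace_Inter)

text \<open>
  Products only raise the degree, so a generator \<open>b\<close> of degree \<open>r\<close> contributes nothing to the part of
  the ideal below degree \<open>r\<close>.  The proof compares the ideal with the set of all elements whose parts
  below degree \<open>r\<close> lie in the ideal of the other generators: this set is an ideal and contains every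
  generator, including \<open>b\<close>.
\<close>

lemma hull_low_degree_without_generator:
  assumes A: "\<forall>a\<in>A. ext_homogeneous a" and b: "b \<in> ext_power r"
    and x: "x \<in> ext_ideal hull A" "x \<in> ext_power k" and k: "k < r"
  shows "x \<in> ext_ideal hull (A - {b})"
proof -
  let ?J = "ext_ideal hull (A - {b})"
  let ?K = "{x. \<forall>k<r. graded_part k x \<in> ?J}"
  have zero: "0 \<in> ?J" using ext_ideal_hull[of "A - {b}"] unfolding ext_ideal_def
    by (simp add: subspace_0)
  have "a \<in> ?K" if a: "a \<in> A" for a
  proof (cases "a = b")
    case True
    then show ?thesis using zero graded_part_homogeneous[OF b] by simp
  next
    case False
    then have "a \<in> ?J" using a by (simp add: hull_inc)
    moreover obtain d where "a \<in> ext_power d" using A a unfolding ext_homogeneous_def by blast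
    ultimately show ?thesis using zero by (simp add: graded_part_homogeneous[where r = d])
  qed
  then have "ext_ideal hull A \<subseteq> ?K"
    using ext_ideal_low_degree_parts[OF ext_ideal_hull] by (intro hull_minimal) auto
  then have "graded_part k x \<in> ?J" using x(1) k by blast
  then show ?thesis using graded_part_homogeneous[OF x(2)] by simp
qed

lemma minimal_generator_not_redundant:
  assumes "minimal_homogeneous_generators A I" "b \<in> A"
  shows "b \<notin> ext_ideal hull (A - {b})"
proof
  assume "b \<in> ext_ideal hull (A - {b})"
  then have "A \<subseteq> ext_ideal hull (A - {b})" using hull_subset[of "A - {b}" ext_ideal] by blast
  then have "ext_ideal hull A \<subseteq> ext_ideal hull (A - {b})"
    using ext_ideal_hull by (rule hull_minimal)
  then have "ext_ideal hull (A - {b}) = I"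
    using assms(1) hull_mono[of "A - {b}" A ext_ideal]
    unfolding minimal_homogeneous_generators_def by blast
  moreover have "A - {b} \<subset> A" using assms(2) by blast
  ultimately show False
    using assms(1) unfolding minimal_homogeneous_generators_def by blast
qed

lemma minimal_generator_nonzero:
  assumes "minimal_homogeneous_generators A I" "b \<in> A"
  shows "b \<noteq> 0"
proof -
  have "0 \<in> ext_ideal hull (A - {b})"
    using ext_ideal_hull[of "A - {b}"] unfolding ext_ideal_def by (simp add: subspace_0)
  then show ?thesis using minimal_generator_not_redundant[OF assms] by auto
qed

text \<open>
  If \<open>b\<close> were in this span, it would be in the ideal of the other generators: \<open>W\<close> consists of multiples
  of lower-degree elements, which are in that ideal by \<open>hull_low_degree_without_generator\<close>.
\<close>

lemma generators_independent_modulo_lower_degree: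
  assumes gen: "minimal_homogeneous_generators A I" and b: "b \<in> A" "b \<in> ext_power r"
    and W: "W \<subseteq> {c \<^bold>\<and> x | c x k. x \<in> I \<inter> ext_power k \<and> k < r}"
  shows "b \<notin> span (W \<union> (A \<inter> ext_power r - {b}))"
proof
  let ?J = "ext_ideal hull (A - {b})"
  have ideal: "ext_ideal ?J" by (rule ext_ideal_hull)
  have hom: "\<forall>a\<in>A. ext_homogeneous a" and I: "I = ext_ideal hull A"
    using gen unfolding minimal_homogeneous_generators_def by auto
  have "x \<in> ?J" if "x \<in> I \<inter> ext_power k" "k < r" for x k
    using hull_low_degree_without_generator[OF hom b(2)] that I by blast
  then have "W \<subseteq> ?J" using W ideal unfolding ext_ideal_def by blast
  moreover have "A \<inter> ext_power r - {b} \<subseteq> ?J" using hull_subset[of "A - {b}" ext_ideal] by blast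
  ultimately have "span (W \<union> (A \<inter> ext_power r - {b})) \<subseteq> ?J"
    using ideal unfolding ext_ideal_def by (intro span_minimal) auto
  moreover assume "b \<in> span (W \<union> (A \<inter> ext_power r - {b}))"
  ultimately show False using minimal_generator_not_redundant[OF gen b(1)] by blast
qed

lemma dim_Un_independent_modulo:
  fixes W B :: "('a::euclidean_space) set"
  assumes "finite B" "\<And>b. b \<in> B \<Longrightarrow> b \<notin> span (W \<union> (B - {b}))"
  shows "dim (W \<union> B) = dim W + card B"
  using assms
proof (induction B rule: finite_induct)
  case empty
  then show ?case by simp
next
  case (insert b B)
  have "c \<notin> span (W \<union> (B - {c}))" if "c \<in> B" for c
    using insert(4)[of c] that span_mono[of "W \<union> (B - {c})" "W \<union> (insert b B - {c})"] by blast
  then have "dim (W \<union> B) = dim W + card B" using insert by blast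
  moreover have "b \<notin> span (W \<union> B)" using insert(2) insert(4)[of b] by simp
  ultimately show ?case using insert by (simp add: eucl.dim_insert)
qed

section \<open>Summing over the degrees\<close>

text \<open>
  In the application \<open>\<delta> k\<close> is the density of an ideal in degree \<open>k\<close>, and \<open>\<mu> k\<close> is the share that the
  generators of degree \<open>k\<close> have in it.
\<close>

lemma sum_increments_le:
  fixes \<delta> \<mu> :: "nat \<Rightarrow> real"
  assumes "\<mu> 0 \<le> \<delta> 0" "\<And>k. k < n \<Longrightarrow> \<delta> k + \<mu> (Suc k) \<le> \<delta> (Suc k)"
  shows "(\<Sum>k\<le>n. \<mu> k) \<le> \<delta> n"
  using assms
proof (induction n)
  case (Suc n)
  then show ?case using Suc.prems(2)[of n] by force
qed simp

text \<open>
  If the sum is 1, every inequality in the chain of increments is tight.  So \<open>\<delta>\<close> takes only the values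
  0 and 1 before the last index, and the increment at the jump from 0 to 1 is 1.
\<close>

lemma saturated_increments:
  fixes \<delta> \<mu> :: "nat \<Rightarrow> real"
  assumes "\<mu> 0 \<le> \<delta> 0" "\<And>k. k < n \<Longrightarrow> \<delta> k + \<mu> (Suc k) \<le> \<delta> (Suc k)"
    and "\<And>k. k < n \<Longrightarrow> \<delta> k + \<mu> (Suc k) = \<delta> (Suc k) \<Longrightarrow> \<delta> k = 0 \<or> \<delta> k = 1"
    and "\<delta> n \<le> 1" "(\<Sum>k\<le>n. \<mu> k) = 1"
  shows "\<exists>s\<le>n. \<mu> s = 1"
  using assms
proof (induction n)
  case (Suc n)
  have "(\<Sum>k\<le>n. \<mu> k) \<le> \<delta> n" using Suc.prems by (intro sum_increments_le) auto
  then have eq: "\<delta> n + \<mu> (Suc n) = \<delta> (Suc n)" "(\<Sum>k\<le>n. \<mu> k) = \<delta> n" "\<delta> (Suc n) = 1"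
    using Suc.prems(2)[of n] Suc.prems(4,5) by auto
  show ?case
  proof (cases "\<delta> n = 0")
    case True
    then show ?thesis using eq by auto
  next
    case False
    then have "\<delta> n = 1" using Suc.prems(3)[of n] eq(1) by simp
    then have "\<exists>s\<le>n. \<mu> s = 1" using Suc.prems eq(2) by (intro Suc.IH) auto
    then show ?thesis using le_SucI by blast
  qed
qed auto

theorem theorem2p8:
  fixes I A :: "('n::{finite,linorder} exterior) set"
    and a :: "nat \<Rightarrow> 'n exterior"
    and r :: "nat \<Rightarrow> nat"
    and m :: nat
  assumes "graded_ideal I"
    and "minimal_homogeneous_generators A I"
    and "bij_betw a {1..m} A"
    and "\<And>i. i \<in> {1..m} \<Longrightarrow> a i \<in> ext_power (r i)"
  shows "(\<Sum>i=1..m. 1 / real (CARD('n) choose r i)) \<le> 1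
    \<and> ((\<Sum>i=1..m. 1 / real (CARD('n) choose r i)) = 1
        \<longrightarrow> (\<exists>s\<le>CARD('n). span A = ext_power s))"
proof -
  let ?n = "CARD('n)"
  let ?A = "\<lambda>k. A \<inter> ext_power k" and ?I = "\<lambda>k. I \<inter> ext_power k"
  define \<delta> where "\<delta> k = dim (?I k) / (?n choose k)" for k
  define \<mu> where "\<mu> k = card (?A k) / (?n choose k)" for k
  note gen = assms(2)
  have finA: "finite A" using bij_betw_finite[OF assms(3)] by simp
  have ideal: "ext_ideal I" and I: "I = ext_ideal hull A"
    using gen ext_ideal_hull[of A] unfolding minimal_homogeneous_generators_def by auto
  have AI: "A \<subseteq> I" using I hull_subset[of A ext_ideal] by simp
  have subI: "subspace (?I k)" for k
    using ideal subspace_ext_power unfolding ext_ideal_def by (blast intro: subspace_inter)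
  have pos: "real (?n choose k) > 0" if "k \<le> ?n" for k using that by simp
  \<comment> \<open>A generator is nonzero, so it has a nonzero coefficient that determines its degree.\<close>
  have degree: "r i \<le> ?n \<and> (\<forall>k. a i \<in> ext_power k \<longleftrightarrow> k = r i)" if i: "i \<in> {1..m}" for i
  proof -
    have "a i \<noteq> 0"
      using minimal_generator_nonzero[OF gen] assms(3) i by (auto simp: bij_betw_def)
    then obtain S where S: "a i $ S \<noteq> 0" by (auto simp: vec_eq_iff)
    then have "card S = k" if "a i \<in> ext_power k" for k using that by (simp add: ext_power_iff)
    then show ?thesis using assms(4)[OF i] by (metis card_mono finite subset_UNIV)
  qed
  have "(\<Sum>i=1..m. 1 / real (?n choose r i)) =
      (\<Sum>k\<le>?n. \<Sum>i | i \<in> {1..m} \<and> r i = k. 1 / real (?n choose r i))"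
    using degree by (subst sum.group) auto
  also have "\<dots> = (\<Sum>k\<le>?n. \<mu> k)"
  proof (rule sum.cong[OF refl])
    fix k
    let ?D = "{i. i \<in> {1..m} \<and> r i = k}"
    have "a ` ?D = ?A k" using assms(3) degree by (auto simp: bij_betw_def)
    moreover have "inj_on a ?D"
      using bij_betw_imp_inj_on[OF assms(3)] by (rule inj_on_subset) auto
    ultimately have "card ?D = card (?A k)" by (metis card_image)
    then show "(\<Sum>i | i \<in> {1..m} \<and> r i = k. 1 / real (?n choose r i)) = \<mu> k"
      unfolding \<mu>_def by simp
  qed
  finally have sum_eq: "(\<Sum>i=1..m. 1 / real (?n choose r i)) = (\<Sum>k\<le>?n. \<mu> k)" .
  have cardA: "dim (?A k) = card (?A k)" for k
    using dim_Un_independent_modulo[of "?A k" "{}"] finA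
      generators_independent_modulo_lower_degree[OF gen, of _ k "{}"] by simp
  have start: "\<mu> 0 \<le> \<delta> 0"
    using AI dim_subset[of "?A 0" "?I 0"] cardA[of 0] unfolding \<mu>_def \<delta>_def by auto
  have step: "\<delta> k + \<mu> (Suc k) \<le> \<delta> (Suc k) \<and>
      (\<delta> k + \<mu> (Suc k) = \<delta> (Suc k) \<longrightarrow> \<delta> k = 0 \<or> \<delta> k = 1)" if k: "k < ?n" for k
  proof -
    \<comment> \<open>The part of \<open>I\<close> in degree \<open>k + 1\<close> that comes from degree \<open>k\<close>; the LYM inequality bounds its
      dimension from below, and the generators of degree \<open>k + 1\<close> are independent modulo its span.\<close>
    let ?P = "{blade {j} \<^bold>\<and> x | j x. x \<in> ?I k}"
    have "b \<notin> span (?P \<union> (?A (Suc k) - {b}))" if "b \<in> ?A (Suc k)" for b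
      using that by (intro generators_independent_modulo_lower_degree[OF gen]) blast+
    then have dim: "dim (?P \<union> ?A (Suc k)) = dim ?P + card (?A (Suc k))"
      using finA by (intro dim_Un_independent_modulo) auto
    have "blade {j} \<in> ext_power 1" for j :: 'n
      by (auto simp: ext_power_iff blade_nth split: if_splits)
    then have P: "?P \<subseteq> ?I (Suc k)"
      using ideal wedge_ext_power[of _ 1 _ k] unfolding ext_ideal_def by fastforce
    then have "?P \<union> ?A (Suc k) \<subseteq> ?I (Suc k)" using AI by blast
    then have "dim ?P + card (?A (Suc k)) \<le> dim (?I (Suc k))"
      unfolding dim[symmetric] by (rule dim_subset)
    then have "real (dim ?P) + card (?A (Suc k)) \<le> dim (?I (Suc k))" by linarith
    then have new: "dim ?P / (?n choose Suc k) + \<mu> (Suc k) \<le> \<delta> (Suc k)"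
      unfolding \<mu>_def \<delta>_def using pos[of "Suc k"] k
      by (simp add: add_divide_distrib[symmetric] divide_right_mono)
    have "span ?P \<subseteq> ?I (Suc k)" using P subI by (rule span_minimal)
    then have LYM: "\<delta> k \<le> dim ?P / (?n choose Suc k)"
        "\<delta> k = dim ?P / (?n choose Suc k) \<Longrightarrow> dim (?I k) = 0 \<or> dim (?I k) = ?n choose k"
      using local_LYM_subspace[of "?I k" k "span ?P", OF subI _ subspace_span _ k]
      unfolding \<delta>_def dim_span by (auto intro: span_base)
    have "\<delta> k = 0 \<or> \<delta> k = 1" if "\<delta> k + \<mu> (Suc k) = \<delta> (Suc k)"
      using LYM new that pos[of k] k unfolding \<delta>_def by force
    then show ?thesis using LYM(1) new by linarith
  qed
  have top: "\<delta> ?n \<le> 1"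
    using dim_subset[of "?I ?n" "ext_power ?n"] dim_ext_power[where 'n = 'n, of ?n]
    unfolding \<delta>_def by simp
  have le: "(\<Sum>k\<le>?n. \<mu> k) \<le> 1"
    using sum_increments_le[of \<mu> \<delta> ?n] start step top by force
  have "\<exists>s\<le>?n. span A = ext_power s" if sum1: "(\<Sum>k\<le>?n. \<mu> k) = 1"
  proof -
    obtain s where s: "s \<le> ?n" "\<mu> s = 1"
      using saturated_increments[of \<mu> \<delta> ?n] start step top sum1 by blast
    have "(\<Sum>k\<in>{..?n} - {s}. \<mu> k) = 0"
      using s sum1 by (simp add: sum_diff1)
    moreover have "\<mu> k \<ge> 0" for k unfolding \<mu>_def by simp
    ultimately have zero: "\<mu> k = 0" if "k \<le> ?n" "k \<noteq> s" for k
      using that sum_nonneg_eq_0_iff[of "{..?n} - {s}" \<mu>] by simp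
    have "A \<subseteq> ext_power s"
    proof
      fix b assume b: "b \<in> A"
      then obtain i where i: "i \<in> {1..m}" "b = a i" using assms(3) by (auto simp: bij_betw_def)
      then have "b \<in> ?A (r i)" "r i \<le> ?n" using b degree by auto
      then have "\<mu> (r i) \<noteq> 0" unfolding \<mu>_def using finA by auto
      then show "b \<in> ext_power s" using zero degree i by blast
    qed
    moreover from this have "dim A = ?n choose s"
      using cardA[of s] s pos[OF s(1)] unfolding \<mu>_def by (simp add: Int_absorb2)
    ultimately have "span A = span (ext_power s)"
      using dim_ext_power[where 'n = 'n, of s] by (intro dim_eq_span) auto
    also have "\<dots> = ext_power s" using subspace_ext_power by (simp add: span_eq_iff)
    finally show ?thesis using s(1) by blast
  qed
  then show ?thesis using le sum_eq by simp
qed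

end
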